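(* The unconditional stability region $D$ of the IMEX BDF2 method contains the disk $D(0,\frac13)$, and the unconditional stability region $D$ of the IMEX BDF3 method contains the disk $D(0,\frac17)$.
   Context: $D(0,r)=\{\mu\in\mathbb{C}:|\mu|<r\}$ is the open disk. Each method has polynomials $\rho,\sigma,\sigma^*$: for IMEX BDF2, $\rho(\zeta)=\frac32\zeta^2-2\zeta+\frac12$, $\sigma(\zeta)=\zeta^2$, $\sigma^*(\zeta)=2\zeta-1$; for IMEX BDF3, $\rho(\zeta)=\frac{11}{6}\zeta^3-3\zeta^2+\frac32\zeta-\frac13$, $\sigma(\zeta)=\zeta^3$, $\sigma^*(\zeta)=3\zeta^2-3\zeta+1$. For an integer $m\ge0$, $z\in\mathbb{R}_{<0}$ and $\mu\in\mathbb{C}$, the characteristic equation (of the method applied to $y'(t)=-\lambda(y(t)+\mu y(t-\tau))$, $z=-\lambda h$, $\tau=mh$) is $$\zeta^m(\rho(\zeta)-z\sigma(\zeta))+z\mu\,\sigma^*(\zeta)=0,$$ and for $z=-\infty$ it is understood (dividing by $z$ and letting $z\to-\infty$) as $-\zeta^m\sigma(\zeta)+\mu\,\sigma^*(\zeta)=0$. It is called stable for given $m$, $z$, $\mu$ if all its roots $\zeta\in\mathbb{C}$ satisfy $|\zeta|<1$. The unconditional stability region $D$ is the set of all $\mu\in\mathbb{C}$ such that the characteristic equation is stable for all $z\in\mathbb{R}_{<0}\cup\{-\infty\}$ and all integers $m\ge0$. *)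

theory Defs
  imports "HOL-Analysis.Analysis" "HOL-Computational_Algebra.Polynomial"
begin

record imex_method =
  rho_poly :: "complex poly"
  sigma_poly :: "complex poly"
  sigma_star_poly :: "complex poly"

definition imex_bdf2 :: imex_method where
  "imex_bdf2 = \<lparr>rho_poly = [:1/2, -2, 3/2:], sigma_poly = [:0, 0, 1:], sigma_star_poly = [:-1, 2:]\<rparr>"

definition imex_bdf3 :: imex_method where
  "imex_bdf3 = \<lparr>rho_poly = [:-1/3, 3/2, -3, 11/6:], sigma_poly = [:0, 0, 0, 1:], sigma_star_poly = [:1, -3, 3:]\<rparr>"

text \<open>
  The left-hand side of the characteristic equation as a polynomial in \<open>\<zeta>\<close>. It is only meant
  for \<open>z < 0\<close> in the extended reals. The value at \<open>-\<infinity>\<close> is the limit after division by \<open>z\<close>,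
  see \<open>char_poly_tendsto\<close> below.
\<close>

definition char_poly :: "imex_method \<Rightarrow> nat \<Rightarrow> ereal \<Rightarrow> complex \<Rightarrow> complex poly" where
  "char_poly M m z \<mu> =
    (if z = -\<infinity> then - (monom 1 m * sigma_poly M) + smult \<mu> (sigma_star_poly M)
     else let x = complex_of_real (real_of_ereal z) in
       monom 1 m * (rho_poly M - smult x (sigma_poly M)) + smult (x * \<mu>) (sigma_star_poly M))"

lemma char_poly_tendsto:
  "((\<lambda>x. poly (char_poly M m (ereal x) \<mu>) \<zeta> / complex_of_real x)
      \<longlongrightarrow> poly (char_poly M m (-\<infinity>) \<mu>) \<zeta>) at_bot"
proof -
  let ?r = "\<zeta> ^ m * poly (rho_poly M) \<zeta>" and ?L = "poly (char_poly M m (-\<infinity>) \<mu>) \<zeta>"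
  have alg: "p * r * inverse x + (c * t - p * s) = (p * (r - x * s) + x * c * t) / x"
    if "x \<noteq> 0" for p r s c t x :: complex
    using that by (simp add: field_simps)
  have "((\<lambda>x::real. inverse x) \<longlongrightarrow> 0) at_bot"
    by (rule tendsto_mono[OF at_bot_le_at_infinity tendsto_inverse_0])
  then have "((\<lambda>x::real. complex_of_real (inverse x)) \<longlongrightarrow> of_real 0) at_bot"
    by (rule tendsto_of_real)
  then have "((\<lambda>x::real. ?r * complex_of_real (inverse x) + ?L) \<longlongrightarrow> ?r * of_real 0 + ?L) at_bot"
    by (intro tendsto_add tendsto_mult tendsto_const)
  moreover have "\<forall>\<^sub>F x::real in at_bot. ?r * complex_of_real (inverse x) + ?L =
      poly (char_poly M m (ereal x) \<mu>) \<zeta> / complex_of_real x"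
    using eventually_gt_at_bot[of "0::real"]
    by eventually_elim (simp only: char_poly_def, simp add: Let_def poly_monom alg)
  ultimately have "((\<lambda>x. poly (char_poly M m (ereal x) \<mu>) \<zeta> / complex_of_real x)
      \<longlongrightarrow> ?r * of_real 0 + ?L) at_bot"
    by (rule Lim_transform_eventually)
  then show ?thesis
    by simp
qed

definition char_stable :: "imex_method \<Rightarrow> nat \<Rightarrow> ereal \<Rightarrow> complex \<Rightarrow> bool" where
  "char_stable M m z \<mu> \<longleftrightarrow> (\<forall>\<zeta>. poly (char_poly M m z \<mu>) \<zeta> = 0 \<longrightarrow> norm \<zeta> < 1)"

definition unconditional_stability_region :: "imex_method \<Rightarrow> complex set" where
  "unconditional_stability_region M = {\<mu>. \<forall>z<0. \<forall>m. char_stable M m z \<mu>}"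

end

theory Submission
  imports Defs
begin

text \<open>
  Put \<open>u = 1 - 1/\<zeta>\<close>, so that \<open>\<bar>\<zeta>\<bar> \<ge> 1\<close> means \<open>\<bar>1 - u\<bar> \<le> 1\<close>. After division by \<open>\<zeta>\<^sup>k\<close> the BDF
  polynomial \<open>\<rho>\<close> becomes \<open>\<delta>(u) = u + u\<^sup>2/2 + \<dots> + u\<^sup>k/k\<close> and \<open>\<sigma>\<^sup>*\<close> becomes \<open>\<gamma>(u) = 1 - u\<^sup>k\<close>, which is
  bounded by \<open>2\<^sup>k - 1\<close>. A root with \<open>\<bar>\<zeta>\<bar> \<ge> 1\<close> would give \<open>\<bar>\<delta>(u) + a\<bar> \<le> a \<bar>\<mu>\<bar> \<bar>\<gamma>(u)\<bar>\<close> with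
  \<open>a = -z > 0\<close>. This is impossible if \<open>Re \<delta>(u) \<ge> 0\<close>, which always holds for \<open>k = 2\<close>. For \<open>k = 3\<close>,
  \<open>Re \<delta>(u) < 0\<close> forces \<open>\<bar>\<gamma>(u)\<bar> \<le> 3\<close> and \<open>\<bar>Re \<delta>(u)\<bar> \<le> \<bar>Im \<delta>(u)\<bar>\<close>, and then \<open>\<bar>\<delta>(u) + a\<bar> \<ge> a/2\<close>.
\<close>

text \<open>Shared by both methods. The delay enters only through \<open>\<zeta> ^ m\<close>, whose
  norm is at least 1 when \<open>norm \<zeta> \<ge> 1\<close>, so the two inequalities need not
  mention \<open>m\<close>. \<open>finite\<close> excludes such roots for \<open>z = - a\<close>,
  \<open>infinite\<close> those for \<open>z = -\<infinity>\<close>.\<close>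

lemma mem_unconditional_stability_regionI:
  fixes M :: imex_method and \<gamma> \<delta> :: "complex \<Rightarrow> complex"
  assumes sigma: "\<And>\<zeta>. \<zeta> \<noteq> 0 \<Longrightarrow> poly (sigma_poly M) \<zeta> = \<zeta> ^ k"
    and rho: "\<And>\<zeta>. \<zeta> \<noteq> 0 \<Longrightarrow> poly (rho_poly M) \<zeta> = \<zeta> ^ k * \<delta> (1 - 1 / \<zeta>)"
    and sigma_star: "\<And>\<zeta>. \<zeta> \<noteq> 0 \<Longrightarrow> poly (sigma_star_poly M) \<zeta> = \<zeta> ^ k * \<gamma> (1 - 1 / \<zeta>)"
    and infinite: "\<And>u. norm (1 - u) \<le> 1 \<Longrightarrow> norm \<mu> * norm (\<gamma> u) < 1"
    and finite: "\<And>u a. norm (1 - u) \<le> 1 \<Longrightarrow> 0 < a \<Longrightarrow>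
      a * (norm \<mu> * norm (\<gamma> u)) < norm (\<delta> u + complex_of_real a)"
  shows "\<mu> \<in> unconditional_stability_region M"
proof -
  have "norm \<zeta> < 1" if z: "z < 0" and root: "poly (char_poly M m z \<mu>) \<zeta> = 0" for z m \<zeta>
  proof (rule ccontr)
    assume "\<not> norm \<zeta> < 1"
    then have ge1: "1 \<le> norm \<zeta>" and nz: "\<zeta> \<noteq> 0"
      by auto
    define u where "u = 1 - 1 / \<zeta>"
    have u: "norm (1 - u) \<le> 1"
      using ge1 nz by (simp add: u_def norm_divide divide_le_eq_1)
    have absorb: "norm v \<le> norm (\<zeta> ^ m * v)" for v
      using ge1 mult_right_mono[of 1 "norm \<zeta> ^ m" "norm v"]
      by (simp add: norm_mult norm_power one_le_power)
    show False
    proof (cases z)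
      case (real x)
      have "\<zeta> ^ k * (\<zeta> ^ m * (\<delta> u - x) + x * \<mu> * \<gamma> u) = 0"
        using root by (simp add: char_poly_def real Let_def poly_monom sigma[OF nz] rho[OF nz]
            sigma_star[OF nz] algebra_simps flip: u_def)
      then have "\<zeta> ^ m * (\<delta> u - x) = - (x * \<mu> * \<gamma> u)"
        using nz by (simp add: eq_neg_iff_add_eq_0)
      then have "norm (\<delta> u - x) \<le> norm (x * \<mu> * \<gamma> u)"
        using absorb[of "\<delta> u - x"] by simp
      then show False
        using finite[OF u, of "- x"] z real by (simp add: norm_mult mult_ac)
    next
      case MInf
      have "\<zeta> ^ k * (\<mu> * \<gamma> u - \<zeta> ^ m * 1) = 0"
        using root by (simp add: char_poly_def MInf poly_monom sigma[OF nz]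
            sigma_star[OF nz] algebra_simps flip: u_def)
      then have "\<zeta> ^ m * 1 = \<mu> * \<gamma> u"
        using nz by simp
      then show False
        using absorb[of 1] infinite[OF u] by (simp add: norm_mult)
    qed (use z in simp)
  qed
  then show ?thesis
    unfolding unconditional_stability_region_def char_stable_def by blast
qed

text \<open>Factor \<open>1 - u^k\<close> as \<open>1 - u\<close> times a geometric sum and use
  \<open>norm u \<le> 2\<close>. The bound is attained at \<open>u = 2\<close>, that is
  \<open>\<zeta> = -1\<close>; its values 3 and 7 are the reciprocals of the two radii.\<close>

lemma norm_one_minus_power_le:
  fixes u :: complex
  assumes "norm (1 - u) \<le> 1" "0 < k"
  shows "norm (1 - u ^ k) \<le> 2 ^ k - 1"
proof -
  have "norm u \<le> 2"
    using assms(1) norm_triangle_ineq4[of 1 "1 - u"] by simp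
  have "norm (1 - u ^ k) = norm (1 - u) * norm (\<Sum>i<k. u ^ i)"
    by (simp add: one_diff_power_eq norm_mult)
  also have "\<dots> \<le> 1 * (\<Sum>i<k. 2 ^ i)"
    using assms(1) \<open>norm u \<le> 2\<close>
    by (intro mult_mono sum_norm_le) (auto simp: norm_power power_mono)
  also have "\<dots> = 2 ^ k - 1"
    by (simp add: geometric_sum)
  finally show ?thesis .
qed

lemma norm_add_of_real_ge:
  assumes "0 \<le> Re d" "0 \<le> a"
  shows "a \<le> norm (d + complex_of_real a)"
  using assms complex_Re_le_cmod[of "d + complex_of_real a"] by simp

text \<open>\<open>a\<close> is at most \<open>\<bar>Re d + a\<bar> + \<bar>Re d\<bar>\<close>,
  hence at most \<open>\<bar>Re d + a\<bar> + \<bar>Im d\<bar>\<close>, and the norm dominates both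
  summands.\<close>

lemma half_le_norm_add_of_real:
  assumes "\<bar>Re d\<bar> \<le> \<bar>Im d\<bar>"
  shows "a / 2 \<le> norm (d + complex_of_real a)"
  using assms abs_Re_le_cmod[of "d + complex_of_real a"] abs_Im_le_cmod[of "d + complex_of_real a"]
  by simp

lemma norm_one_minus_le_one_iff:
  "norm (1 - u) \<le> 1 \<longleftrightarrow> (Re u)\<^sup>2 + (Im u)\<^sup>2 \<le> 2 * Re u"
  by (simp add: cmod_def power2_eq_square algebra_simps)

text \<open>Inserting \<open>q^2 \<le> 2p - p^2\<close> for \<open>u = p + iq\<close> leaves the
  lower bound \<open>p^2\<close>.\<close>

lemma Re_bdf2_nonneg:
  assumes "norm (1 - u) \<le> 1"
  shows "0 \<le> Re (u + u\<^sup>2 / 2)"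
proof -
  have "Re (u + u\<^sup>2 / 2) = Re u + ((Re u)\<^sup>2 - (Im u)\<^sup>2) / 2"
    by (simp add: Re_power2)
  then show ?thesis
    using assms zero_le_power2[of "Re u"] unfolding norm_one_minus_le_one_iff by argo
qed

text \<open>The sign condition confines \<open>u\<close> to \<open>0 \<le> p < 3/4\<close>, so
  \<open>u\<close> is small enough for the first claim. The second follows from the chain
  \<open>\<bar>Re\<bar> \<le> p \<le> \<bar>q\<bar> \<le> \<bar>Im\<bar>\<close>.\<close>

lemma bdf3_left_half_plane:
  fixes u :: complex
  assumes u: "norm (1 - u) \<le> 1" and neg: "Re (u + u\<^sup>2 / 2 + u ^ 3 / 3) < 0"
  shows "norm (1 - u ^ 3) \<le> 3"
    and "\<bar>Re (u + u\<^sup>2 / 2 + u ^ 3 / 3)\<bar> \<le> \<bar>Im (u + u\<^sup>2 / 2 + u ^ 3 / 3)\<bar>"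
proof -
  define p q where "p = Re u" and "q = Im u"
  have disk: "p\<^sup>2 + q\<^sup>2 \<le> 2 * p"
    using u by (simp add: norm_one_minus_le_one_iff p_def q_def)
  then have p0: "0 \<le> p"
    using zero_le_power2[of p] zero_le_power2[of q] by linarith
  have re: "Re (u + u\<^sup>2 / 2 + u ^ 3 / 3) = p + p\<^sup>2 / 2 + p ^ 3 / 3 - q\<^sup>2 * (1 / 2 + p)"
    by (simp add: p_def q_def power2_eq_square power3_eq_cube field_simps)
  have im: "Im (u + u\<^sup>2 / 2 + u ^ 3 / 3) = q * (1 + p + p\<^sup>2 - q\<^sup>2 / 3)"
    by (simp add: p_def q_def power2_eq_square power3_eq_cube field_simps)
  \<comment> \<open>Eliminating \<open>q\<close> by the disk condition bounds the real part below by
    \<open>-p^2 (1 - 4p/3)\<close>, which is nonnegative from \<open>p = 3/4\<close> on.\<close>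
  have "q\<^sup>2 * (1 / 2 + p) \<le> (2 * p - p\<^sup>2) * (1 / 2 + p)"
    using disk p0 by (intro mult_right_mono) auto
  then have re_ge: "- (p * (p * (1 - 4 / 3 * p))) \<le> Re (u + u\<^sup>2 / 2 + u ^ 3 / 3)"
    unfolding re by (simp add: power2_eq_square power3_eq_cube field_simps)
  have p34: "p < 3 / 4"
  proof (rule ccontr)
    assume "\<not> p < 3 / 4"
    then have "p * (p * (1 - 4 / 3 * p)) \<le> 0"
      using p0 by (intro mult_nonneg_nonpos) auto
    then show False
      using re_ge neg by linarith
  qed
  \<comment> \<open>\<open>2p < 3/2 < 25/16\<close>, and \<open>5/4\<close> still has a cube below
    2.\<close>
  have "norm u ^ 2 \<le> (5 / 4)\<^sup>2"
    using disk p34 unfolding cmod_power2 p_def q_def by (simp add: power2_eq_square)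
  then have "norm u \<le> 5 / 4"
    by (rule power2_le_imp_le) simp
  then have "norm u ^ 3 \<le> (5 / 4) ^ 3"
    by (intro power_mono) auto
  also have "\<dots> \<le> (2 :: real)"
    by (simp add: power3_eq_cube)
  finally have "norm (u ^ 3) \<le> 2"
    by (simp add: norm_power)
  then show "norm (1 - u ^ 3) \<le> 3"
    using norm_triangle_ineq4[of 1 "u ^ 3"] by simp
  \<comment> \<open>If \<open>q^2 < p\<close>, the real part is at least
    \<open>p/2 - p^2/2 + p^3/3\<close>, which is nonnegative since \<open>p < 3/4\<close>.\<close>
  have pq: "p \<le> q\<^sup>2"
  proof (rule ccontr)
    assume "\<not> p \<le> q\<^sup>2"
    then have "q\<^sup>2 * (1 / 2 + p) \<le> p * (1 / 2 + p)"
      using p0 by (intro mult_right_mono) auto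
    moreover have "p * p \<le> p * (3 / 4)"
      using p0 p34 by (intro mult_left_mono) auto
    moreover have "0 \<le> p ^ 3"
      using p0 by simp
    ultimately show False
      using neg[unfolded re] p0 unfolding power2_eq_square by argo
  qed
  have "p * (p * (1 - 4 / 3 * p)) \<le> p * 1"
    using p0 p34 by (intro mult_left_mono mult_le_one) auto
  moreover have "p * (1 - 4 / 3 * p) \<le> 1"
    using p0 p34 by (intro mult_le_one) auto
  ultimately have re_le: "\<bar>Re (u + u\<^sup>2 / 2 + u ^ 3 / 3)\<bar> \<le> p"
    using re_ge neg by linarith
  have "p\<^sup>2 \<le> q\<^sup>2"
    using p0 p34 pq mult_left_le[of p p] by (simp add: power2_eq_square)
  then have "p \<le> \<bar>q\<bar>"
    using p0 abs_le_square_iff[of p q] by simp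
  \<comment> \<open>The disk condition gives \<open>q^2 / 3 \<le> 2p/3\<close>, which
    \<open>p\<close> absorbs.\<close>
  moreover have "1 \<le> 1 + p + p\<^sup>2 - q\<^sup>2 / 3"
    using disk p0 zero_le_power2[of p] by linarith
  then have "\<bar>q\<bar> * 1 \<le> \<bar>q\<bar> * \<bar>1 + p + p\<^sup>2 - q\<^sup>2 / 3\<bar>"
    by (intro mult_left_mono) auto
  ultimately show "\<bar>Re (u + u\<^sup>2 / 2 + u ^ 3 / 3)\<bar> \<le> \<bar>Im (u + u\<^sup>2 / 2 + u ^ 3 / 3)\<bar>"
    using re_le unfolding im abs_mult by linarith
qed

lemma ball_subset_region_bdf2:
  "ball 0 (1 / 3) \<subseteq> unconditional_stability_region imex_bdf2"
proof
  fix \<mu> :: complex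
  assume "\<mu> \<in> ball 0 (1 / 3)"
  then have mu: "norm \<mu> < 1 / 3"
    by simp
  have bound: "norm \<mu> * norm (1 - u\<^sup>2) < 1" if "norm (1 - u) \<le> 1" for u :: complex
    using norm_one_minus_power_le[OF that, of 2] mu mult_left_mono[of "norm (1 - u\<^sup>2)" 3 "norm \<mu>"]
    by simp
  show "\<mu> \<in> unconditional_stability_region imex_bdf2"
  proof (rule mem_unconditional_stability_regionI
      [where k = 2 and \<gamma> = "\<lambda>u. 1 - u\<^sup>2" and \<delta> = "\<lambda>u. u + u\<^sup>2 / 2"])
    fix u :: complex and a :: real
    assume u: "norm (1 - u) \<le> 1" and a: "0 < a"
    have "a * (norm \<mu> * norm (1 - u\<^sup>2)) < a"
      using bound[OF u] a by simp
    also have "a \<le> norm (u + u\<^sup>2 / 2 + complex_of_real a)"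
      using Re_bdf2_nonneg[OF u] a by (intro norm_add_of_real_ge) auto
    finally show "a * (norm \<mu> * norm (1 - u\<^sup>2)) < norm (u + u\<^sup>2 / 2 + complex_of_real a)" .
  qed (use bound in \<open>auto simp: imex_bdf2_def field_simps power2_eq_square\<close>)
qed

lemma ball_subset_region_bdf3:
  "ball 0 (1 / 7) \<subseteq> unconditional_stability_region imex_bdf3"
proof
  fix \<mu> :: complex
  assume "\<mu> \<in> ball 0 (1 / 7)"
  then have mu: "norm \<mu> < 1 / 7"
    by simp
  have bound: "norm \<mu> * norm (1 - u ^ 3) < 1" if "norm (1 - u) \<le> 1" for u :: complex
    using norm_one_minus_power_le[OF that, of 3] mu mult_left_mono[of "norm (1 - u ^ 3)" 7 "norm \<mu>"]
    by simp
  show "\<mu> \<in> unconditional_stability_region imex_bdf3"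
  proof (rule mem_unconditional_stability_regionI
      [where k = 3 and \<gamma> = "\<lambda>u. 1 - u ^ 3" and \<delta> = "\<lambda>u. u + u\<^sup>2 / 2 + u ^ 3 / 3"])
    fix u :: complex and a :: real
    assume u: "norm (1 - u) \<le> 1" and a: "0 < a"
    let ?d = "u + u\<^sup>2 / 2 + u ^ 3 / 3"
    show "a * (norm \<mu> * norm (1 - u ^ 3)) < norm (?d + complex_of_real a)"
    proof (cases "0 \<le> Re ?d")
      case True
      have "a * (norm \<mu> * norm (1 - u ^ 3)) < a"
        using bound[OF u] a by simp
      also have "a \<le> norm (?d + complex_of_real a)"
        using True a by (intro norm_add_of_real_ge) auto
      finally show ?thesis .
    next
      case False
      then have neg: "Re ?d < 0"
        by simp
      \<comment> \<open>The bound 3 in place of 7 gives \<open>3/7 < 1/2\<close>, which makes up for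
        the factor 1/2 lost in the lower bound on \<open>norm (?d + a)\<close>.\<close>
      have "norm \<mu> * norm (1 - u ^ 3) < 1 / 2"
        using mult_left_mono[OF bdf3_left_half_plane(1)[OF u neg], of "norm \<mu>"] mu by simp
      then have "a * (norm \<mu> * norm (1 - u ^ 3)) < a * (1 / 2)"
        using a by (rule mult_strict_left_mono)
      also have "\<dots> \<le> norm (?d + complex_of_real a)"
        using half_le_norm_add_of_real[OF bdf3_left_half_plane(2)[OF u neg]] by simp
      finally show ?thesis .
    qed
  qed (use bound in \<open>auto simp: imex_bdf3_def field_simps power2_eq_square power3_eq_cube\<close>)
qed

theorem corollary25:
  shows "ball 0 (1/3) \<subseteq> unconditional_stability_region imex_bdf2 \<and>
         ball 0 (1/7) \<subseteq> unconditional_stability_region imex_bdf3"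
  using ball_subset_region_bdf2 ball_subset_region_bdf3 by blast

end
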